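(* Let $(A,\mu,\alpha,\beta)$ be a regular BiHom-algebra over a field $\mathbb{K}$ of characteristic $0$. If $(A,\mu,\alpha,\beta)$ is BiHom-alternative, then it is BiHom-flexible.
   Context: All vector spaces are over a field $\mathbb{K}$ of characteristic $0$. A BiHom-algebra is a quadruple $(A,\mu,\alpha,\beta)$ where $A$ is a vector space, $\mu:A\otimes A\to A$, $\alpha,\beta:A\to A$ are linear maps, and $\alpha\beta=\beta\alpha$. It is regular if $\alpha$ and $\beta$ are bijective. The BiHom-associator is the trilinear map $as_{\alpha,\beta}(x,y,z)=\mu(\mu(x,y),\beta(z))-\mu(\alpha(x),\mu(y,z))$. The BiHom-algebra is: - left BiHom-alternative if $as_{\alpha,\beta}(\beta(x),\alpha(y),z)+as_{\alpha,\beta}(\beta(y),\alpha(x),z)=0$ for all $x,y,z\in A$; - right BiHom-alternative if $as_{\alpha,\beta}(x,\beta(y),\alpha(z))+as_{\alpha,\beta}(x,\beta(z),\alpha(y))=0$ for all $x,y,z\in A$; - BiHom-alternative if it is both left and right BiHom-alternative; - BiHom-flexible if $as_{\alpha,\beta}(\beta^{2}(x),\alpha\beta(y),\alpha^{2}(z))+as_{\alpha,\beta}(\beta^{2}(z),\alpha\beta(y),\alpha^{2}(x))=0$ for all $x,y,z\in A$. *)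

theory Defs
  imports Complex_Main
begin

text \<open>A linear map \<open>A \<otimes> A \<rightarrow> A\<close> is given as a bilinear map \<open>\<mu> :: 'a \<Rightarrow> 'a \<Rightarrow> 'a\<close>.
  The structure maps \<open>\<alpha>\<close>, \<open>\<beta>\<close> are not required to be multiplicative with respect to \<open>\<mu>\<close>.\<close>

locale bihom_algebra = vector_space scale
  for scale :: "'k::field \<Rightarrow> 'a::ab_group_add \<Rightarrow> 'a" +
  fixes \<mu> :: "'a \<Rightarrow> 'a \<Rightarrow> 'a"
    and \<alpha> \<beta> :: "'a \<Rightarrow> 'a"
  assumes linear_mult_left: "Vector_Spaces.linear scale scale (\<lambda>x. \<mu> x y)"
    and linear_mult_right: "Vector_Spaces.linear scale scale (\<lambda>y. \<mu> x y)"
    and linear_alpha: "Vector_Spaces.linear scale scale \<alpha>"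
    and linear_beta: "Vector_Spaces.linear scale scale \<beta>"
    and alpha_beta_commute: "\<alpha> \<circ> \<beta> = \<beta> \<circ> \<alpha>"

locale regular_bihom_algebra = bihom_algebra +
  assumes bij_alpha: "bij \<alpha>"
    and bij_beta: "bij \<beta>"

definition bihom_associator ::
    "('a::ab_group_add \<Rightarrow> 'a \<Rightarrow> 'a) \<Rightarrow> ('a \<Rightarrow> 'a) \<Rightarrow> ('a \<Rightarrow> 'a) \<Rightarrow> 'a \<Rightarrow> 'a \<Rightarrow> 'a \<Rightarrow> 'a" where
  "bihom_associator \<mu> \<alpha> \<beta> x y z = \<mu> (\<mu> x y) (\<beta> z) - \<mu> (\<alpha> x) (\<mu> y z)"

definition left_bihom_alternative ::
    "('a::ab_group_add \<Rightarrow> 'a \<Rightarrow> 'a) \<Rightarrow> ('a \<Rightarrow> 'a) \<Rightarrow> ('a \<Rightarrow> 'a) \<Rightarrow> bool" where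
  "left_bihom_alternative \<mu> \<alpha> \<beta> \<longleftrightarrow>
    (\<forall>x y z. bihom_associator \<mu> \<alpha> \<beta> (\<beta> x) (\<alpha> y) z
           + bihom_associator \<mu> \<alpha> \<beta> (\<beta> y) (\<alpha> x) z = 0)"

definition right_bihom_alternative ::
    "('a::ab_group_add \<Rightarrow> 'a \<Rightarrow> 'a) \<Rightarrow> ('a \<Rightarrow> 'a) \<Rightarrow> ('a \<Rightarrow> 'a) \<Rightarrow> bool" where
  "right_bihom_alternative \<mu> \<alpha> \<beta> \<longleftrightarrow>
    (\<forall>x y z. bihom_associator \<mu> \<alpha> \<beta> x (\<beta> y) (\<alpha> z)
           + bihom_associator \<mu> \<alpha> \<beta> x (\<beta> z) (\<alpha> y) = 0)"

definition bihom_alternative ::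
    "('a::ab_group_add \<Rightarrow> 'a \<Rightarrow> 'a) \<Rightarrow> ('a \<Rightarrow> 'a) \<Rightarrow> ('a \<Rightarrow> 'a) \<Rightarrow> bool" where
  "bihom_alternative \<mu> \<alpha> \<beta> \<longleftrightarrow>
    left_bihom_alternative \<mu> \<alpha> \<beta> \<and> right_bihom_alternative \<mu> \<alpha> \<beta>"

definition bihom_flexible ::
    "('a::ab_group_add \<Rightarrow> 'a \<Rightarrow> 'a) \<Rightarrow> ('a \<Rightarrow> 'a) \<Rightarrow> ('a \<Rightarrow> 'a) \<Rightarrow> bool" where
  "bihom_flexible \<mu> \<alpha> \<beta> \<longleftrightarrow>
    (\<forall>x y z. bihom_associator \<mu> \<alpha> \<beta> ((\<beta> ^^ 2) x) (\<alpha> (\<beta> y)) ((\<alpha> ^^ 2) z)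
           + bihom_associator \<mu> \<alpha> \<beta> ((\<beta> ^^ 2) z) (\<alpha> (\<beta> y)) ((\<alpha> ^^ 2) x) = 0)"

end

theory Submission
  imports Defs
begin

text \<open>Evaluate the associator on \<open>\<beta>\<^sup>2 x\<close>, \<open>\<alpha>\<beta> y\<close>, \<open>\<alpha>\<^sup>2 z\<close>. With these twists, and because \<open>\<alpha>\<close>
  and \<open>\<beta>\<close> commute, left alternativity makes the value change sign when \<open>x\<close> and \<open>y\<close>
  are exchanged, and right alternativity makes it change sign when \<open>y\<close> and \<open>z\<close> are exchanged. The
  transposition \<open>(x z)\<close> is the product of three such adjacent transpositions, hence it also changes
  the sign, which is flexibility.\<close>

theorem proposition2p4:
  fixes scale :: "'k::field_char_0 \<Rightarrow> 'a::ab_group_add \<Rightarrow> 'a"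
    and \<mu> :: "'a \<Rightarrow> 'a \<Rightarrow> 'a"
    and \<alpha> \<beta> :: "'a \<Rightarrow> 'a"
  assumes "regular_bihom_algebra scale \<mu> \<alpha> \<beta>"
    and "bihom_alternative \<mu> \<alpha> \<beta>"
  shows "bihom_flexible \<mu> \<alpha> \<beta>"
proof -
  interpret regular_bihom_algebra scale \<mu> \<alpha> \<beta> by fact
  define T where "T x y z = bihom_associator \<mu> \<alpha> \<beta> (\<beta> (\<beta> x)) (\<alpha> (\<beta> y)) (\<alpha> (\<alpha> z))" for x y z
  have comm: "\<alpha> (\<beta> x) = \<beta> (\<alpha> x)" for x
    using alpha_beta_commute by (rule comp_eq_dest)
  have swap_left: "T x y z = - T y x z" for x y z
    using assms(2)
    unfolding bihom_alternative_def left_bihom_alternative_def T_def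
    by (simp add: eq_neg_iff_add_eq_0)
  have swap_right: "T x y z = - T x z y" for x y z
    using assms(2)
    unfolding bihom_alternative_def right_bihom_alternative_def T_def comm
    by (simp add: eq_neg_iff_add_eq_0)
  have "T x y z + T z y x = 0" for x y z
  proof -
    have "T x y z = - T y x z" by (rule swap_left)
    also have "\<dots> = T y z x" using swap_right[of y x z] by simp
    also have "\<dots> = - T z y x" by (rule swap_left)
    finally show ?thesis by simp
  qed
  then show ?thesis
    by (simp add: bihom_flexible_def T_def numeral_2_eq_2)
qed

end
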